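(* Let $A$ be a finite set, $f:2^A\to[0,1]$ and $c:2^A\to\mathbb{R}_{\ge0}$. For any segment $[\alpha,\beta]\subseteq[0,1]$, the recursive procedure $\mathtt{CV}(\alpha,\beta)$ (described in the context) returns the set of all critical values in that segment, that is, the set of all critical values in $(\alpha,\beta]$.
   Context: Contract setting: $A=\{1,\dots,n\}$ is a set of actions, $f:2^A\to[0,1]$ is the reward function and $c:2^A\to\mathbb{R}_{\ge0}$ is the cost function. A contract is a number $\alpha\in[0,1]$, and the agent's utility is $u_a(\alpha,S)=\alpha f(S)-c(S)$ for $S\subseteq A$. The agent's best response (demand) $S_\alpha$ is a set maximizing $u_a(\alpha,\cdot)$ over all $S\subseteq A$; ties are broken in favor of sets with larger $f$, and remaining ties are broken by a consistent rule independent of $\alpha$ (e.g. a fixed total order on the subsets of $A$). Critical values are the values of $\alpha$ at which the agent's demand changes: $\alpha\in(0,1]$ is critical if for every $\varepsilon>0$ there is $x\in[0,1]$ with $\alpha-\varepsilon<x<\alpha$ and $S_x\ne S_\alpha$ (by convention $0$ is also counted as critical). Procedure $\mathtt{CV}(\alpha,\beta)$, which has access to a demand oracle (given $\alpha$, returns $S_\alpha$) and to value oracles for $f$ and $c$: 1. If $S_\alpha=S_\beta$, return $\emptyset$. 2. Set $\gamma=\dfrac{c(S_\alpha)-c(S_\beta)}{f(S_\alpha)-f(S_\beta)}$. 3. If $S_\gamma=S_\beta$, return $\{\gamma\}$. 4. Otherwise, return $\mathtt{CV}(\alpha,\gamma)\cup\mathtt{CV}(\gamma,\beta)$. *)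

theory Defs
  imports Complex_Main "HOL-Library.Monad_Syntax"
begin

definition utility :: "('a set \<Rightarrow> real) \<Rightarrow> ('a set \<Rightarrow> real) \<Rightarrow> real \<Rightarrow> 'a set \<Rightarrow> real" where
  "utility f c \<alpha> S = \<alpha> * f S - c S"

definition best_responses ::
  "'a set \<Rightarrow> ('a set \<Rightarrow> real) \<Rightarrow> ('a set \<Rightarrow> real) \<Rightarrow> real \<Rightarrow> 'a set set" where
  "best_responses A f c \<alpha> = {S. is_arg_max (utility f c \<alpha>) (\<lambda>T. T \<subseteq> A) S}"

definition preferred_responses ::
  "'a set \<Rightarrow> ('a set \<Rightarrow> real) \<Rightarrow> ('a set \<Rightarrow> real) \<Rightarrow> real \<Rightarrow> 'a set set" where
  "preferred_responses A f c \<alpha> = {S. is_arg_max f (\<lambda>T. T \<in> best_responses A f c \<alpha>) S}"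

text \<open>
  A consistent tie-breaking rule is a choice function: it sees only the family of sets that are
  still tied, and not the contract. Selecting the first set in a fixed total order on the subsets
  of the ground set is a special case, see \<open>tie_breaking_rule_linear_order\<close> below.
\<close>

definition tie_breaking_rule :: "'a set \<Rightarrow> ('a set set \<Rightarrow> 'a set) \<Rightarrow> bool" where
  "tie_breaking_rule A \<tau> \<longleftrightarrow> (\<forall>\<S>. \<S> \<subseteq> Pow A \<and> \<S> \<noteq> {} \<longrightarrow> \<tau> \<S> \<in> \<S>)"

definition demand ::
  "'a set \<Rightarrow> ('a set \<Rightarrow> real) \<Rightarrow> ('a set \<Rightarrow> real) \<Rightarrow> ('a set set \<Rightarrow> 'a set) \<Rightarrow> real \<Rightarrow> 'a set" where
  "demand A f c \<tau> \<alpha> = \<tau> (preferred_responses A f c \<alpha>)"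

definition critical_value :: "(real \<Rightarrow> 'a set) \<Rightarrow> real \<Rightarrow> bool" where
  "critical_value D \<alpha> \<longleftrightarrow>
     \<alpha> = 0 \<or>
     (\<alpha> \<in> {0<..1} \<and> (\<forall>\<epsilon>>0. \<exists>x\<in>{0..1}. \<alpha> - \<epsilon> < x \<and> x < \<alpha> \<and> D x \<noteq> D \<alpha>))"

text \<open>
  The procedure, with the demand oracle \<open>D\<close> and the value oracles \<open>f\<close> and \<open>c\<close> as parameters.
  The result is \<open>Some X\<close> if the recursion terminates and returns \<open>X\<close>, and \<open>None\<close> if it diverges.
\<close>

partial_function (option) CV ::
  "(real \<Rightarrow> 'a set) \<Rightarrow> ('a set \<Rightarrow> real) \<Rightarrow> ('a set \<Rightarrow> real) \<Rightarrow> real \<Rightarrow> real \<Rightarrow> real set option" where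
  "CV D f c \<alpha> \<beta> =
     (if D \<alpha> = D \<beta> then Some {}
      else let \<gamma> = (c (D \<alpha>) - c (D \<beta>)) / (f (D \<alpha>) - f (D \<beta>)) in
        if D \<gamma> = D \<beta> then Some {\<gamma>}
        else do {
          X \<leftarrow> CV D f c \<alpha> \<gamma>;
          Y \<leftarrow> CV D f c \<gamma> \<beta>;
          Some (X \<union> Y)
        })"

lemma tie_breaking_rule_linear_order:
  assumes "finite A" and lin: "linear_order_on (Pow A) r"
  shows "tie_breaking_rule A (\<lambda>\<S>. THE S. S \<in> \<S> \<and> (\<forall>T\<in>\<S>. (S, T) \<in> r))"
proof -
  have refl: "(S, S) \<in> r" if "S \<subseteq> A" for S
    using lin that by (auto simp: order_on_defs intro: refl_onD)
  have total: "(S, T) \<in> r \<or> (T, S) \<in> r" if "S \<subseteq> A" "T \<subseteq> A" for S T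
    using lin that refl unfolding order_on_defs total_on_def by (metis PowI)
  have trans: "(S, U) \<in> r" if "(S, T) \<in> r" "(T, U) \<in> r" for S T U
    using lin that unfolding order_on_defs by (meson transD)
  have antisym: "S = T" if "(S, T) \<in> r" "(T, S) \<in> r" for S T
    using lin that unfolding order_on_defs by (meson antisymD)
  have least: "\<exists>S\<in>\<S>. \<forall>T\<in>\<S>. (S, T) \<in> r" if "finite \<S>" "\<S> \<noteq> {}" "\<S> \<subseteq> Pow A" for \<S>
    using that
  proof (induction \<S> rule: finite_ne_induct)
    case (singleton S)
    then show ?case using refl by auto
  next
    case (insert S \<S>)
    then obtain M where M: "M \<in> \<S>" "\<forall>T\<in>\<S>. (M, T) \<in> r" by auto
    have sub: "S \<subseteq> A" "M \<subseteq> A" using insert.prems M(1) by auto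
    show ?case
    proof (cases "(M, S) \<in> r")
      case True
      then show ?thesis using M by auto
    next
      case False
      then have "(S, M) \<in> r" using total[OF sub] by blast
      then have "\<forall>T\<in>insert S \<S>. (S, T) \<in> r" using M(2) trans[of S M] refl[OF sub(1)] by auto
      then show ?thesis by blast
    qed
  qed
  have "(THE S. S \<in> \<S> \<and> (\<forall>T\<in>\<S>. (S, T) \<in> r)) \<in> \<S>" if "\<S> \<subseteq> Pow A" "\<S> \<noteq> {}" for \<S>
  proof -
    have "finite \<S>" using that(1) assms(1) finite_subset by blast
    from least[OF this that(2,1)]
    obtain M where M: "M \<in> \<S>" "\<forall>T\<in>\<S>. (M, T) \<in> r" by (elim bexE)
    have "(THE S. S \<in> \<S> \<and> (\<forall>T\<in>\<S>. (S, T) \<in> r)) = M"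
      using M by (intro the_equality conjI antisym) simp_all
    then show ?thesis using M(1) by simp
  qed
  then show ?thesis unfolding tie_breaking_rule_def by blast
qed

end

theory Submission imports Defs begin

text \<open>
  Along increasing contracts the demand is weakly increasing in \<open>f\<close>, and the demand at a contract
  is determined by its reward. When the demands at the two ends of \<open>[\<alpha>, \<beta>]\<close> differ, \<open>\<gamma>\<close> is
  the contract at which the agent is indifferent between them. If \<open>S\<^sub>\<gamma> = S\<^sub>\<beta>\<close>, then the demand is
  \<open>S\<^sub>\<alpha>\<close> on \<open>[\<alpha>, \<gamma>)\<close> and \<open>S\<^sub>\<beta>\<close> on \<open>[\<gamma>, \<beta>]\<close>. Otherwise \<open>f S\<^sub>\<gamma>\<close> lies strictly between \<open>f S\<^sub>\<alpha>\<close> and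
  \<open>f S\<^sub>\<beta>\<close>, so both recursive calls see fewer rewards and the recursion terminates.
\<close>

section \<open>Maximizers over finite sets and local tests for critical values\<close>

lemma ex_is_arg_max_if_finite:
  fixes g :: "'b \<Rightarrow> 'c :: linorder"
  assumes "finite {x. P x}" and "\<exists>x. P x"
  shows "\<exists>x. is_arg_max g P x"
proof -
  have "Max (g ` {x. P x}) \<in> g ` {x. P x}"
    using assms by (intro Max_in) auto
  then obtain x where "P x" and x: "g x = Max (g ` {x. P x})"
    by auto
  moreover have "g y \<le> g x" if "P y" for y
    unfolding x using assms(1) that by (intro Max_ge) auto
  ultimately show ?thesis
    by (auto simp: is_arg_max_linorder)
qed

text \<open>Taking \<epsilon> = x - a in the definition would force a change of demand inside (a,
  x). The bounds on a give x > 0, which excludes the convention for 0.\<close>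

lemma not_critical_value_if_locally_constant:
  assumes "0 \<le> a" and "a < x" and "\<And>y. a < y \<Longrightarrow> y < x \<Longrightarrow> D y = D x"
  shows "\<not> critical_value D x"
proof
  assume "critical_value D x"
  with assms(1,2) obtain y where "x - (x - a) < y" "y < x" "D y \<noteq> D x"
    unfolding critical_value_def by (metis diff_gt_0_iff_gt less_le_not_le)
  with assms(3) show False by simp
qed

lemma critical_value_if_jump:
  assumes "0 \<le> a" and "a < x" and "x \<le> 1" and "\<And>y. a < y \<Longrightarrow> y < x \<Longrightarrow> D y \<noteq> D x"
  shows "critical_value D x"
proof -
  have "\<exists>y\<in>{0..1}. x - \<epsilon> < y \<and> y < x \<and> D y \<noteq> D x" if "\<epsilon> > 0" for \<epsilon>
  proof -
    obtain y where "max a (x - \<epsilon>) < y" "y < x"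
      using dense[of "max a (x - \<epsilon>)" x] \<open>\<epsilon> > 0\<close> \<open>a < x\<close> by auto
    with assms show ?thesis by (intro bexI[of _ y]) auto
  qed
  with assms show ?thesis unfolding critical_value_def by auto
qed

section \<open>Demand as a function of the contract\<close>

locale contract_setting =
  fixes A :: "'a set" and f c :: "'a set \<Rightarrow> real" and \<tau> :: "'a set set \<Rightarrow> 'a set"
  assumes finite_actions: "finite A" and tie_breaking: "tie_breaking_rule A \<tau>"
begin

abbreviation D :: "real \<Rightarrow> 'a set" where
  "D \<equiv> demand A f c \<tau>"

lemma demand_in_preferred: "D x \<in> preferred_responses A f c x"
proof -
  have fin: "finite {S. S \<subseteq> A}"
    using finite_actions by simp
  then have "best_responses A f c x \<noteq> {}"
    using ex_is_arg_max_if_finite[of "\<lambda>T. T \<subseteq> A"] unfolding best_responses_def by auto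
  moreover have sub: "best_responses A f c x \<subseteq> Pow A"
    unfolding best_responses_def is_arg_max_def by auto
  then have "finite (best_responses A f c x)"
    using finite_actions finite_subset by blast
  ultimately have "preferred_responses A f c x \<noteq> {}"
    using ex_is_arg_max_if_finite[of "\<lambda>T. T \<in> best_responses A f c x"]
    unfolding preferred_responses_def by auto
  moreover have "preferred_responses A f c x \<subseteq> Pow A"
    using sub unfolding preferred_responses_def is_arg_max_def by auto
  ultimately show ?thesis
    using tie_breaking unfolding demand_def tie_breaking_rule_def by blast
qed

lemma demand_subset: "D x \<subseteq> A"
  using demand_in_preferred[of x]
  by (simp add: preferred_responses_def best_responses_def is_arg_max_linorder)

lemma demand_optimal: "T \<subseteq> A \<Longrightarrow> x * f T - c T \<le> x * f (D x) - c (D x)"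
  using demand_in_preferred[of x]
  by (simp add: preferred_responses_def best_responses_def is_arg_max_linorder utility_def)

text \<open>A tie would make T a best response with larger reward, against the tie-breaking by
  \<open>f\<close>.\<close>

lemma demand_optimal_strict:
  assumes "T \<subseteq> A" and "f (D x) < f T"
  shows "x * f T - c T < x * f (D x) - c (D x)"
proof (rule ccontr)
  assume "\<not> ?thesis"
  then have "x * f S - c S \<le> x * f T - c T" if "S \<subseteq> A" for S
    using demand_optimal[OF that, of x] by simp
  then have "T \<in> best_responses A f c x"
    using \<open>T \<subseteq> A\<close> by (simp add: best_responses_def is_arg_max_linorder utility_def)
  then show False
    using demand_in_preferred[of x] \<open>f (D x) < f T\<close>
    by (auto simp: preferred_responses_def is_arg_max_linorder)
qed

text \<open>At a fixed contract, equal utility and equal reward force equal cost. In this form the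
  contract enters only through the reward and cost of \<open>D x\<close>.\<close>

lemma preferred_responses_eq:
  "preferred_responses A f c x = {S. S \<subseteq> A \<and> f S = f (D x) \<and> c S = c (D x)}"
    (is "?P = ?Q")
proof
  show "?P \<subseteq> ?Q"
  proof
    fix S assume "S \<in> ?P"
    then have "S \<subseteq> A" "f (D x) \<le> f S" "f S \<le> f (D x)"
      "x * f (D x) - c (D x) \<le> x * f S - c S"
      using demand_in_preferred[of x] demand_subset[of x]
      by (auto simp: preferred_responses_def best_responses_def is_arg_max_linorder utility_def)
    with demand_optimal[of S x] show "S \<in> ?Q" by auto
  qed
  show "?Q \<subseteq> ?P"
    using demand_in_preferred[of x]
    by (auto simp: preferred_responses_def best_responses_def is_arg_max_linorder utility_def)
qed

text \<open>Optimality at both contracts makes the costs agree as well, so the tied families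
  coincide, and \<tau> sees nothing but the family.\<close>

lemma demand_eqI:
  assumes "f (D x) = f (D y)"
  shows "D x = D y"
proof -
  have "c (D x) = c (D y)"
    using demand_optimal[OF demand_subset, of x y] demand_optimal[OF demand_subset, of y x] assms
    by simp
  with assms have "preferred_responses A f c x = preferred_responses A f c y"
    unfolding preferred_responses_eq by simp
  then show ?thesis unfolding demand_def by simp
qed

lemma demand_mono:
  assumes "x \<le> y"
  shows "f (D x) \<le> f (D y)"
proof (rule ccontr)
  assume "\<not> ?thesis"
  then have less: "f (D y) < f (D x)" by simp
  \<comment> \<open>Add the strict optimality of \<open>D y\<close> at y to the optimality of
    \<open>D x\<close> at x; the costs cancel.\<close>
  have "(y - x) * (f (D x) - f (D y)) < 0"
    using demand_optimal_strict[OF demand_subset less] demand_optimal[OF demand_subset, of x y]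
    by (simp add: algebra_simps)
  moreover have "(y - x) * (f (D x) - f (D y)) \<ge> 0"
    using assms less by simp
  ultimately show False by simp
qed

lemma demand_constant_between:
  assumes "D x = D z" and "x \<le> y" and "y \<le> z"
  shows "D y = D z"
  using demand_mono[OF assms(2)] demand_mono[OF assms(3)] assms(1) by (intro demand_eqI) simp

lemma no_critical_value_if_demand_eq:
  assumes "0 \<le> a" and "D a = D b" and "a < x" and "x \<le> b"
  shows "\<not> critical_value D x"
proof (rule not_critical_value_if_locally_constant)
  fix y assume "a < y" "y < x"
  with assms show "D y = D x"
    using demand_constant_between[of a b y] demand_constant_between[of a b x] by simp
qed fact+

section \<open>The contract of indifference between two demands\<close>

definition indifference_point :: "real \<Rightarrow> real \<Rightarrow> real" where
  "indifference_point a b = (c (D a) - c (D b)) / (f (D a) - f (D b))"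

context
  fixes a b :: real
  assumes le: "a \<le> b" and neq: "D a \<noteq> D b"
begin

lemma reward_less: "f (D a) < f (D b)"
  using demand_mono[OF le] demand_eqI[of a b] neq by (simp add: order_less_le) blast

lemma indifferent:
  "indifference_point a b * f (D a) - c (D a) = indifference_point a b * f (D b) - c (D b)"
proof -
  have "indifference_point a b * (f (D a) - f (D b)) = c (D a) - c (D b)"
    using reward_less unfolding indifference_point_def by simp
  then show ?thesis by (simp add: algebra_simps)
qed

lemma indifference_point_greater: "a < indifference_point a b"
proof -
  have "a * (f (D b) - f (D a)) < indifference_point a b * (f (D b) - f (D a))"
    using demand_optimal_strict[OF demand_subset reward_less] indifferent
    by (simp add: algebra_simps)
  then show ?thesis using reward_less by simp
qed

text \<open>Not strict, unlike the bound at a: a tie at b is resolved in favor of the larger reward,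
  that of \<open>D b\<close>, so the point may be b itself.\<close>

lemma indifference_point_le: "indifference_point a b \<le> b"
proof -
  have "indifference_point a b * (f (D b) - f (D a)) \<le> b * (f (D b) - f (D a))"
    using demand_optimal[OF demand_subset, of b a] indifferent
    by (simp add: algebra_simps)
  then show ?thesis using reward_less by simp
qed

text \<open>\<open>D a\<close> ties there with \<open>D b\<close>, which has larger reward, so
  \<open>D a\<close> cannot be demanded.\<close>

lemma reward_less_at_indifference_point: "f (D a) < f (D (indifference_point a b))"
proof (rule ccontr)
  assume "\<not> ?thesis"
  then have "D (indifference_point a b) = D a"
    using demand_mono[of a "indifference_point a b"] indifference_point_greater
    by (intro demand_eqI) simp
  then show False
    using demand_optimal_strict[OF demand_subset, of "indifference_point a b" b]
      reward_less indifferent by simp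
qed

text \<open>By indifference \<open>D a\<close> is optimal at the point too. A set of larger reward
  loses utility faster as the contract falls, so below the point it is strictly worse than
  \<open>D a\<close>.\<close>

lemma demand_below_indifference_point:
  assumes eq: "D (indifference_point a b) = D b" and "a \<le> x" and "x < indifference_point a b"
  shows "D x = D a"
proof (rule ccontr)
  let ?g = "indifference_point a b"
  assume "D x \<noteq> D a"
  then have less: "f (D a) < f (D x)"
    using demand_mono[OF \<open>a \<le> x\<close>] demand_eqI[of x a] by fastforce
  have "?g * f (D x) - c (D x) \<le> ?g * f (D a) - c (D a)"
    using demand_optimal[OF demand_subset, of ?g x] indifferent eq by simp
  moreover have "x * f (D a) - c (D a) \<le> x * f (D x) - c (D x)"
    by (rule demand_optimal[OF demand_subset])
  ultimately have "(?g - x) * (f (D x) - f (D a)) \<le> 0"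
    by (simp add: algebra_simps)
  moreover have "(?g - x) * (f (D x) - f (D a)) > 0"
    using less assms(3) by simp
  ultimately show False by simp
qed

lemma critical_value_iff_indifference_point:
  assumes eq: "D (indifference_point a b) = D b"
    and "0 \<le> a" and "b \<le> 1" and "a < x" and "x \<le> b"
  shows "critical_value D x \<longleftrightarrow> x = indifference_point a b"
proof (cases x "indifference_point a b" rule: linorder_cases)
  case less
  then have "D a = D x"
    using demand_below_indifference_point[OF eq, of x] \<open>a < x\<close> by simp
  with less assms show ?thesis
    using no_critical_value_if_demand_eq[of a x x] by simp
next
  case equal
  have "critical_value D (indifference_point a b)"
  proof (rule critical_value_if_jump[OF \<open>0 \<le> a\<close> indifference_point_greater])
    fix y assume "a < y" "y < indifference_point a b"
    then show "D y \<noteq> D (indifference_point a b)"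
      using demand_below_indifference_point[OF eq, of y] eq neq by simp
  qed (use indifference_point_le \<open>b \<le> 1\<close> in simp)
  with equal show ?thesis by simp
next
  case greater
  with assms show ?thesis
    using no_critical_value_if_demand_eq[of "indifference_point a b" b x]
      indifference_point_greater by simp
qed

end

section \<open>Termination and correctness of the recursion\<close>

lemma CV_eq_critical_values:
  assumes "0 \<le> a" and "a \<le> b" and "b \<le> 1"
  shows "CV D f c a b = Some {x \<in> {a<..b}. critical_value D x}"
  using assms
\<comment> \<open>The measure counts attainable rewards in a half-open interval, so splitting at
  \<open>f (D g)\<close> partitions them between the two calls.\<close>
proof (induction "card {v \<in> f ` Pow A. f (D a) < v \<and> v \<le> f (D b)}" arbitrary: a b
    rule: less_induct)
  case less
  let ?V = "\<lambda>a b. {v \<in> f ` Pow A. f (D a) < v \<and> v \<le> f (D b)}"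
  have fin: "finite (?V a b)" for a b
    using finite_actions by simp
  have mem: "f (D x) \<in> f ` Pow A" for x
    using demand_subset by blast
  define g where "g = indifference_point a b"
  consider "D a = D b" | "D a \<noteq> D b" "D g = D b" | "D a \<noteq> D b" "D g \<noteq> D b"
    by blast
  then show ?case
  proof cases
    case 1
    then have "{x \<in> {a<..b}. critical_value D x} = {}"
      using no_critical_value_if_demand_eq[OF \<open>0 \<le> a\<close> 1] by auto
    with 1 show ?thesis by (subst CV.simps) simp
  next
    case 2
    have "{x \<in> {a<..b}. critical_value D x} = {g}"
      using critical_value_iff_indifference_point[OF \<open>a \<le> b\<close> 2(1)] 2(2) less.prems
        indifference_point_greater[OF \<open>a \<le> b\<close> 2(1)] indifference_point_le[OF \<open>a \<le> b\<close> 2(1)]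
      by (auto simp: g_def)
    moreover have "CV D f c a b = Some {g}"
      using 2 by (subst CV.simps) (simp add: g_def indifference_point_def)
    ultimately show ?thesis by simp
  next
    case 3
    have g: "a < g" "g \<le> b"
      using indifference_point_greater indifference_point_le \<open>a \<le> b\<close> 3(1) by (auto simp: g_def)
    have low: "f (D a) < f (D g)"
      using reward_less_at_indifference_point \<open>a \<le> b\<close> 3(1) by (simp add: g_def)
    have high: "f (D g) < f (D b)"
      using reward_less[OF \<open>g \<le> b\<close> 3(2)] .
    \<comment> \<open>Each call loses a reward: the left one the top value \<open>f (D b)\<close>,
      the right one \<open>f (D g)\<close>, which is its excluded lower end.\<close>
    have "f (D b) \<in> ?V a b - ?V a g"
      using low high mem by simp
    moreover have "?V a g \<subseteq> ?V a b"
      using low high by auto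
    ultimately have "?V a g \<subset> ?V a b"
      by blast
    then have left: "CV D f c a g = Some {x \<in> {a<..g}. critical_value D x}"
      using less.hyps[of a g] psubset_card_mono[OF fin] less.prems g by auto
    have "f (D g) \<in> ?V a b - ?V g b"
      using low high mem by simp
    moreover have "?V g b \<subseteq> ?V a b"
      using low high by auto
    ultimately have "?V g b \<subset> ?V a b"
      by blast
    then have right: "CV D f c g b = Some {x \<in> {g<..b}. critical_value D x}"
      using less.hyps[of g b] psubset_card_mono[OF fin] less.prems g by auto
    have "CV D f c a b =
        Some ({x \<in> {a<..g}. critical_value D x} \<union> {x \<in> {g<..b}. critical_value D x})"
      using 3 left right
      \<comment> \<open>The quotient in the unfolded body is folded back to \<open>g\<close>, so
        that \<open>left\<close> and \<open>right\<close> apply to the recursive calls.\<close>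
      by (subst CV.simps) (simp add: Let_def flip: indifference_point_def g_def)
    also have "{x \<in> {a<..g}. critical_value D x} \<union> {x \<in> {g<..b}. critical_value D x}
        = {x \<in> {a<..b}. critical_value D x}"
      using g by auto
    finally show ?thesis .
  qed
qed

end

theorem claim1:
  fixes A :: "'a set"
    and f c :: "'a set \<Rightarrow> real"
    and \<tau> :: "'a set set \<Rightarrow> 'a set"
    and \<alpha> \<beta> :: real
  assumes "finite A"
    and "\<And>S. S \<subseteq> A \<Longrightarrow> 0 \<le> f S \<and> f S \<le> 1"
    and "\<And>S. S \<subseteq> A \<Longrightarrow> 0 \<le> c S"
    and "tie_breaking_rule A \<tau>"
    and "0 \<le> \<alpha>" and "\<alpha> \<le> \<beta>" and "\<beta> \<le> 1"
  shows "CV (demand A f c \<tau>) f c \<alpha> \<beta>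
         = Some {x \<in> {\<alpha><..\<beta>}. critical_value (demand A f c \<tau>) x}"
proof -
  interpret contract_setting A f c \<tau>
    using assms(1,4) by unfold_locales
  show ?thesis
    using CV_eq_critical_values assms(5-7) .
qed

end
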